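(* Consider the complete quadrilateral in the Euclidean plane consisting of four lines $l_1,l_2,l_3,l_4$ (indices read cyclically modulo $4$) such that $l_{i-1},l_i,l_{i+1}$ form a triangle with circumcircle $C_i$ for $i=1,2,3,4$. Let $A_i$ denote the intersection of $l_i$ and $l_{i+1}$, $P$ the intersection of $l_2$ and $l_4$, and $Q$ the intersection of $l_1$ and $l_3$. Let $\varphi_{A_i}:C_i\to C_{i+1}$ be the pivot map with pivot $A_i$. Then $\varphi:=\varphi_{A_4}\circ\varphi_{A_3}\circ\varphi_{A_2}\circ\varphi_{A_1}$ is the identity map on $C_1$, i.e., the resulting quadrilateral with vertices $X_1$, $X_{i+1}=\varphi_{A_i}(X_i)$ closes for any initial point $X_1$ on $C_1$. The circles $C_1,C_2,C_3,C_4$ pass through a common point $S$, the Steiner point. Moreover, with $\ell_i$ denoting the line through $X_i,A_i,X_{i+1}$, we have: (i) The intersection $X_{13}$ of the lines $\ell_1$ and $\ell_3$ runs on a circle $C_{13}$ through $A_1,A_3$ and $S$. (ii) The intersection $X_{24}$ of the lines $\ell_2$ and $\ell_4$ runs on a circle $C_{24}$ through $A_2,A_4$ and $S$. (iii) The intersection $X$ of the lines $X_1X_3$ and $X_2X_4$ runs on a circle $C$ through $P,Q$ and $S$. (iv) The points $X_1,X_2,X_3,X_4$ are concyclic on a circle $D$ through $S$. (v) The points $X_1,X_3$ and $P$, as well as $X_2,X_4$ and $Q$, are collinear.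
   Context: Pivot map: let $C,C'$ be two circles which intersect in two points or touch each other, and let $A$ be a common point. The map $\varphi_A:C\to C'$ is defined as follows. If $X\in C$, $X\ne A$, then $\varphi_A(X)$ is the second intersection point of the line $XA$ with $C'$ (equal to $A$ if this line is tangent to $C'$ at $A$). If $X=A$, then $\varphi_A(X)$ is the second intersection with $C'$ of the tangent to $C$ at $A$ (equal to $A$ if the circles touch at $A$). Note that $A_i$ lies on both $C_i$ and $C_{i+1}$. The line $\ell_i$ is the line $X_iA_i$ if $X_i\ne A_i$, and the tangent to $C_i$ at $A_i$ if $X_i=A_i$. "Runs on a circle" means that the point stays on one circle, independent of the position of $X_1$, as $X_1$ moves on $C_1$.
   Formalization: In (i)–(iii) the circle is claimed only if the three points it should pass through (A_1,A_3,S; A_2,A_4,S; P,Q,S) are not collinear; if they are, the two lines are shown never to meet in exactly one point. In (iii) X_1 = S is excluded, as then all X_i equal S. *)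

theory Defs
  imports "HOL-Analysis.Analysis"
begin

text \<open>
  The Euclidean plane is modelled by the type \<^typ>\<open>complex\<close>; only its metric and affine structure
  is used below.
\<close>

definition is_line :: "complex set \<Rightarrow> bool" where
  "is_line L \<longleftrightarrow> (\<exists>a b. a \<noteq> b \<and> L = affine hull {a, b})"

definition is_circle :: "complex set \<Rightarrow> bool" where
  "is_circle C \<longleftrightarrow> (\<exists>c r. r > 0 \<and> C = sphere c r)"

definition form_triangle :: "complex set \<Rightarrow> complex set \<Rightarrow> complex set \<Rightarrow> bool" where
  "form_triangle l m n \<longleftrightarrow>
     (\<exists>a b c. \<not> collinear {a, b, c} \<and>
        l = affine hull {b, c} \<and> m = affine hull {c, a} \<and> n = affine hull {a, b})"

text \<open>If the three lines form a triangle, the pairwise intersections are its vertices.\<close>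

definition is_circumcircle :: "complex set \<Rightarrow> complex set \<Rightarrow> complex set \<Rightarrow> complex set \<Rightarrow> bool" where
  "is_circumcircle l m n C \<longleftrightarrow> is_circle C \<and> l \<inter> m \<subseteq> C \<and> m \<inter> n \<subseteq> C \<and> n \<inter> l \<subseteq> C"

text \<open>A line is tangent to a circle at a point iff that point is their only common point.\<close>

definition tangent_line :: "complex set \<Rightarrow> complex \<Rightarrow> complex set" where
  "tangent_line C A = (THE L. is_line L \<and> L \<inter> C = {A})"

text \<open>Intended for a line \<open>L\<close> and a circle \<open>C\<close>, both passing through \<open>A\<close>.\<close>

definition second_intersection :: "complex set \<Rightarrow> complex set \<Rightarrow> complex \<Rightarrow> complex" where
  "second_intersection L C A =
     (if L \<inter> C = {A} then A else (THE Y. Y \<in> L \<inter> C \<and> Y \<noteq> A))"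

definition pivot_line :: "complex set \<Rightarrow> complex \<Rightarrow> complex \<Rightarrow> complex set" where
  "pivot_line C A X = (if X = A then tangent_line C A else affine hull {X, A})"

text \<open>
  The pivot map from \<open>C\<close> to \<open>C'\<close> with pivot \<open>A\<close>. If \<open>X = A\<close> and the circles touch at \<open>A\<close>, the
  tangent to \<open>C\<close> meets \<open>C'\<close> only in \<open>A\<close>, so the value is \<open>A\<close>.
\<close>

definition pivot_map :: "complex set \<Rightarrow> complex set \<Rightarrow> complex \<Rightarrow> complex \<Rightarrow> complex" where
  "pivot_map C C' A X = second_intersection (pivot_line C A X) C' A"

end

theory Submission
  imports Defs
begin

text \<open>
  The four lines are tangent to a parabola whose focus is the Steiner point \<open>S\<close>. After a similarity
  taking \<open>S\<close> to \<open>0\<close>, the tangents with parameters \<open>s\<close> and \<open>t\<close> meet in \<open>(1 + \<i> s) (1 + \<i> t)\<close>, and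
  the circle \<open>C\<^sub>i\<close> has the diameter from \<open>0\<close> to \<open>m\<^sub>i = p\<^sub>i\<^sub>-\<^sub>1 p\<^sub>i p\<^sub>i\<^sub>+\<^sub>1\<close>, where
  \<open>p\<^sub>j = 1 + \<i> t\<^sub>j\<close>. A point of such a circle is \<open>m\<^sub>i Re(u) u\<close> with \<open>|u| = 1\<close>, and by the
  inscribed angle theorem the line joining it to a point \<open>a\<close> of the circle is
  \<open>{a (1 + \<i> r u) | r real}\<close>, which does not depend on \<open>m\<^sub>i\<close>. Hence all pivot maps preserve \<open>u\<close>,
  and so do the points of intersection in (i)--(iii).
\<close>


section \<open>Circles through S and lines, measured relative to S\<close>

definition diameter_circle :: "complex \<Rightarrow> complex \<Rightarrow> complex set" where
  "diameter_circle S m = sphere (S + m / 2) (cmod m / 2)"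

text \<open>The line through \<open>S + a\<close> with direction \<open>\<i> * a * u\<close>. As the
  direction is measured against \<open>a\<close>, for fixed \<open>u\<close> the lines for different
  nonzero \<open>a\<close> are images of one another under spiral similarities about
  \<open>S\<close>.\<close>

definition tilted_line :: "complex \<Rightarrow> complex \<Rightarrow> complex \<Rightarrow> complex set" where
  "tilted_line S a u = range (\<lambda>r. S + a * (1 + \<i> * of_real r * u))"

lemma is_circle_diameter_circle: "m \<noteq> 0 \<Longrightarrow> is_circle (diameter_circle S m)"
  unfolding is_circle_def diameter_circle_def by (intro exI[of _ "S + m/2"] exI[of _ "cmod m / 2"]) auto

lemma endpoint_in_diameter_circle: "S \<in> diameter_circle S m"
  by (simp add: diameter_circle_def dist_norm norm_divide)

lemma Re_mult_self_unit:
  assumes "cmod u = 1"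
  shows "of_real (Re u) * u = (1 + u\<^sup>2) / 2"
proof -
  have "u * cnj u = 1"
    using assms by (simp add: complex_norm_square[symmetric])
  moreover have "of_real (Re u) = (u + cnj u) / 2"
    by (simp add: complex_add_cnj)
  ultimately show ?thesis
    by (simp add: power2_eq_square algebra_simps)
qed

lemma diameter_circle_iff_unit:
  "z \<in> diameter_circle S m \<longleftrightarrow> (\<exists>u. cmod u = 1 \<and> z = S + m * (of_real (Re u) * u))"
proof
  assume z: "z \<in> diameter_circle S m"
  show "\<exists>u. cmod u = 1 \<and> z = S + m * (of_real (Re u) * u)"
  proof (cases "m = 0")
    case True
    then show ?thesis
      using z by (auto simp: diameter_circle_def intro!: exI[of _ 1])
  next
    case False
    \<comment> \<open>\<open>v\<close> is \<open>z\<close> seen from the centre with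
      \<open>m / 2\<close> as unit; its square root halves the central angle to the inscribed angle
      at \<open>S\<close>.\<close>
    define v where "v = 2 * (z - S) / m - 1"
    define u where "u = csqrt v"
    have "S + m / 2 - z = - (m / 2 * v)"
      using False by (simp add: v_def field_simps)
    then have "cmod (m / 2) * cmod v = cmod m / 2"
      using z by (simp only: diameter_circle_def mem_sphere dist_norm norm_minus_cancel norm_mult)
    then have "cmod v = 1"
      using False by (simp add: norm_divide)
    moreover have "u\<^sup>2 = v"
      by (simp add: u_def)
    ultimately have "cmod u = 1"
      by (metis norm_ge_zero norm_power power2_eq_1_iff abs_of_nonneg abs_1 abs_minus)
    moreover have "z = S + m * ((1 + u\<^sup>2) / 2)"
      using False by (simp add: \<open>u\<^sup>2 = v\<close> v_def field_simps)
    ultimately show ?thesis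
      using Re_mult_self_unit by metis
  qed
next
  assume "\<exists>u. cmod u = 1 \<and> z = S + m * (of_real (Re u) * u)"
  then obtain u where u: "cmod u = 1" and z: "z = S + m * (of_real (Re u) * u)"
    by blast
  have "S + m / 2 - z = - (m / 2 * u\<^sup>2)"
    unfolding z Re_mult_self_unit[OF u] by (simp add: field_simps)
  then show "z \<in> diameter_circle S m"
    using u by (simp only: diameter_circle_def mem_sphere dist_norm norm_minus_cancel norm_mult norm_power norm_divide)
      simp
qed

text \<open>Thales: \<open>m - z\<close> is orthogonal to \<open>z\<close> exactly when
  \<open>(m - z) / z\<close> has real part 0. In the proof, division by \<open>z / 2\<close> turns
  membership into \<open>q\<close> being equidistant from 0 and 2.\<close>

lemma diameter_circle_iff_Re:
  assumes "z \<noteq> 0"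
  shows "S + z \<in> diameter_circle S m \<longleftrightarrow> Re (m / z) = 1"
proof -
  define q where "q = m / z"
  have m: "m = z * q"
    using assms by (simp add: q_def)
  have "S + z \<in> diameter_circle S m \<longleftrightarrow> cmod (z / 2 * (q - 2)) = cmod (z / 2 * q)"
  proof -
    have "S + m / 2 - (S + z) = z / 2 * (q - 2)"
      by (simp add: m algebra_simps)
    then show ?thesis
      by (simp only: diameter_circle_def mem_sphere dist_norm) (simp add: m norm_mult norm_divide)
  qed
  also have "\<dots> \<longleftrightarrow> (cmod (q - 2))\<^sup>2 = (cmod q)\<^sup>2"
    using assms by (simp add: norm_mult)
  also have "\<dots> \<longleftrightarrow> Re q = 1"
    unfolding cmod_power2 by (simp add: power2_eq_square algebra_simps)
  finally show ?thesis
    by (simp add: q_def)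
qed

lemma tilted_line_two_points:
  assumes "x \<in> tilted_line S a u" "y \<in> tilted_line S a u" "x \<noteq> y"
  shows "affine hull {x, y} = tilted_line S a u"
proof -
  obtain r s where x: "x = S + a * (1 + \<i> * of_real r * u)" and y: "y = S + a * (1 + \<i> * of_real s * u)"
    using assms by (auto simp: tilted_line_def)
  have "r \<noteq> s"
    using assms(3) x y by auto
  have eq: "x + k *\<^sub>R (y - x) = S + a * (1 + \<i> * of_real (r + k * (s - r)) * u)" for k
    by (simp add: x y scaleR_conv_of_real algebra_simps)
  have "S + a * (1 + \<i> * of_real t * u) = x + ((t - r) / (s - r)) *\<^sub>R (y - x)" for t
    using \<open>r \<noteq> s\<close> by (subst eq) simp
  then have "\<exists>k. S + a * (1 + \<i> * of_real t * u) = x + k *\<^sub>R (y - x)" for t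
    by blast
  moreover have "\<exists>t. x + k *\<^sub>R (y - x) = S + a * (1 + \<i> * of_real t * u)" for k
    using eq by blast
  ultimately show ?thesis
    unfolding affine_hull_2_alt tilted_line_def image_def by blast
qed

lemma base_in_tilted_line: "S + a \<in> tilted_line S a u"
  unfolding tilted_line_def by (rule range_eqI[of _ _ 0]) simp

lemma is_line_tilted_line:
  assumes "a \<noteq> 0" "u \<noteq> 0"
  shows "is_line (tilted_line S a u)"
proof -
  have "S + a * (1 + \<i> * u) \<in> tilted_line S a u"
    unfolding tilted_line_def by (rule range_eqI[of _ _ 1]) simp
  then have "affine hull {S + a, S + a * (1 + \<i> * u)} = tilted_line S a u"
    using assms by (intro tilted_line_two_points base_in_tilted_line) (auto simp: algebra_simps)
  then show ?thesis
    using assms unfolding is_line_def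
    by (intro exI[of _ "S + a"] exI[of _ "S + a * (1 + \<i> * u)"]) (auto simp: algebra_simps)
qed

lemma line_through_is_tilted_line:
  assumes "is_line L" "S + a \<in> L" "a \<noteq> 0"
  obtains u where "cmod u = 1" "L = tilted_line S a u"
proof -
  obtain x y where xy: "x \<noteq> y" "L = affine hull {x, y}"
    using assms(1) by (auto simp: is_line_def)
  obtain b where b: "S + a = x + b *\<^sub>R (y - x)"
    using assms(2) xy by (auto simp: affine_hull_2_alt)
  \<comment> \<open>The direction of \<open>L\<close> relative to the perpendicular
    \<open>\<i> * a\<close>; its normalisation is the required \<open>u\<close>.\<close>
  define d where "d = (y - x) / (\<i> * a)"
  have "d \<noteq> 0"
    using xy assms by (simp add: d_def)
  have yx: "y - x = a * (\<i> * of_real (cmod d) * sgn d)"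
    using \<open>d \<noteq> 0\<close> assms by (simp add: sgn_eq) (simp add: d_def)
  have "S + a * (1 + \<i> * of_real r * sgn d) = x + (b + r / cmod d) *\<^sub>R (y - x)" for r
  proof -
    have "S + a * (1 + \<i> * of_real r * sgn d) = (S + a) + (r / cmod d) *\<^sub>R (y - x)"
      using \<open>d \<noteq> 0\<close> by (simp add: yx scaleR_conv_of_real field_simps)
    then show ?thesis
      by (simp add: b algebra_simps)
  qed
  note eq = this
  have "tilted_line S a (sgn d) = L"
  proof
    show "tilted_line S a (sgn d) \<subseteq> L"
      by (auto simp: tilted_line_def xy affine_hull_2_alt eq)
    show "L \<subseteq> tilted_line S a (sgn d)"
    proof
      fix z assume "z \<in> L"
      then obtain k where "z = x + k *\<^sub>R (y - x)"
        by (auto simp: xy affine_hull_2_alt)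
      then show "z \<in> tilted_line S a (sgn d)"
        unfolding tilted_line_def using eq[of "(k - b) * cmod d"] \<open>d \<noteq> 0\<close>
        by (intro range_eqI[of _ _ "(k - b) * cmod d"]) simp
    qed
  qed
  then show thesis
    using that[of "sgn d"] \<open>d \<noteq> 0\<close> by (simp add: norm_sgn)
qed

lemma unit_point_in_tilted_line:
  assumes "S + a \<in> diameter_circle S m" "a \<noteq> 0" "cmod u = 1"
  shows "S + m * (of_real (Re u) * u) \<in> tilted_line S a u"
proof -
  obtain w where w: "cmod w = 1" and a: "a = m * (of_real (Re w) * w)"
    using assms by (auto simp: diameter_circle_iff_unit)
  have "Re w \<noteq> 0"
    using a assms by auto
  have 1: "(Re u)\<^sup>2 + (Im u)\<^sup>2 = 1" "(Re w)\<^sup>2 + (Im w)\<^sup>2 = 1"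
    using w assms(3) by (auto simp: cmod_def)
  define r where "r = Im (u * cnj w) / Re w"
  \<comment> \<open>Half of \<open>u^2 - w^2\<close> is \<open>u * w\<close> times
    \<open>(u * cnj w - w * cnj u) / 2\<close>, which is \<open>\<i> * Im (u * cnj w)\<close>. As
    \<open>a\<close> is a nonzero real multiple of \<open>m * w\<close>, the chord is a real
    multiple of \<open>\<i> * a * u\<close>.\<close>
  have "of_real (Re u) * u = of_real (Re w) * w + \<i> * of_real (Im (u * cnj w)) * w * u"
    using 1 unfolding complex_eq_iff by simp algebra
  also have "\<dots> = of_real (Re w) * w * (1 + \<i> * of_real r * u)"
  proof -
    have "complex_of_real (Im (u * cnj w)) = of_real (Re w) * of_real r"
      using \<open>Re w \<noteq> 0\<close> by (simp add: r_def flip: of_real_mult)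
    then show ?thesis
      by (simp add: algebra_simps)
  qed
  finally show ?thesis
    by (auto simp: tilted_line_def a)
qed

lemma tilted_line_inter_unit:
  assumes "z \<in> tilted_line S a u" "z \<in> tilted_line S a w" "z \<noteq> S + a" "cmod u = 1" "cmod w = 1"
  shows "u = w \<or> u = - w"
proof -
  obtain r s where z: "z = S + a * (1 + \<i> * of_real r * u)" "z = S + a * (1 + \<i> * of_real s * w)"
    using assms(1,2) unfolding tilted_line_def by blast
  have "a \<noteq> 0" "r \<noteq> 0"
    using z(1) assms(3) by auto
  then have eq: "of_real r * u = of_real s * w"
    using z by (simp add: algebra_simps)
  then have "\<bar>r\<bar> = \<bar>s\<bar>"
    using assms(4,5) by (metis norm_mult norm_of_real mult.right_neutral)
  then consider "s = r" | "s = - r"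
    by arith
  then show ?thesis
  proof cases
    case 1
    then show ?thesis
      using eq \<open>r \<noteq> 0\<close> by simp
  next
    case 2
    then have "of_real r * u = of_real r * (- w)"
      using eq by simp
    then show ?thesis
      using \<open>r \<noteq> 0\<close> by (simp only: mult_cancel_left of_real_eq_0_iff) simp
  qed
qed

text \<open>A point of the circle has its own unit parameter \<open>w\<close> and lies on
  \<open>tilted_line S a w\<close>. On the line for \<open>u\<close> as well, it is
  \<open>S + a\<close> or has \<open>w = u\<close> or \<open>w = - u\<close>; both signs give the
  same point, as \<open>Re u * u\<close> is even in \<open>u\<close>.\<close>

lemma tilted_line_inter_diameter_circle:
  assumes "S + a \<in> diameter_circle S m" "a \<noteq> 0" "cmod u = 1"
  shows "tilted_line S a u \<inter> diameter_circle S m = {S + a, S + m * (of_real (Re u) * u)}"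
proof
  show "{S + a, S + m * (of_real (Re u) * u)} \<subseteq> tilted_line S a u \<inter> diameter_circle S m"
    using assms unit_point_in_tilted_line base_in_tilted_line diameter_circle_iff_unit by blast
  show "tilted_line S a u \<inter> diameter_circle S m \<subseteq> {S + a, S + m * (of_real (Re u) * u)}"
  proof
    fix z assume z: "z \<in> tilted_line S a u \<inter> diameter_circle S m"
    then obtain w where w: "cmod w = 1" "z = S + m * (of_real (Re w) * w)"
      by (auto simp: diameter_circle_iff_unit)
    then have "z \<in> tilted_line S a w"
      using unit_point_in_tilted_line assms by blast
    then have "z = S + a \<or> u = w \<or> u = - w"
      using tilted_line_inter_unit z w assms by blast
    then show "z \<in> {S + a, S + m * (of_real (Re u) * u)}"
      using w by auto
  qed
qed

section \<open>Tangents and pivot maps in terms of the unit parameter\<close>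

text \<open>A tilted line touches the circle when its second intersection falls on
  \<open>S + a\<close>. Any other tangent there, with parameter \<open>w\<close>, satisfies
  \<open>w^2 = u^2\<close>, and opposite parameters give the same line.\<close>

lemma tangent_line_diameter_circle:
  assumes "S + a \<in> diameter_circle S m" "a \<noteq> 0" "cmod u = 1" "S + a = S + m * (of_real (Re u) * u)"
  shows "tangent_line (diameter_circle S m) (S + a) = tilted_line S a u"
  unfolding tangent_line_def
proof (rule the_equality)
  show "is_line (tilted_line S a u) \<and> tilted_line S a u \<inter> diameter_circle S m = {S + a}"
    using tilted_line_inter_diameter_circle is_line_tilted_line assms by fastforce
next
  fix L assume L: "is_line L \<and> L \<inter> diameter_circle S m = {S + a}"
  then obtain w where w: "cmod w = 1" "L = tilted_line S a w"
    using line_through_is_tilted_line assms by (metis Int_iff singletonI)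
  then have "S + m * (of_real (Re w) * w) = S + a"
    using tilted_line_inter_diameter_circle[of S a m w] L assms by auto
  then have "of_real (Re w) * w = of_real (Re u) * u"
    using assms by auto
  then have "w\<^sup>2 = u\<^sup>2"
    using Re_mult_self_unit w assms by simp
  then have "w = u \<or> w = - u"
    by (simp add: power2_eq_iff)
  moreover have "tilted_line S a (- u) = tilted_line S a u"
  proof -
    have "tilted_line S a (- u) = (\<lambda>r. S + a * (1 + \<i> * of_real r * u)) ` range uminus"
      by (simp only: tilted_line_def image_image) simp
    then show ?thesis
      by (simp only: tilted_line_def surj_uminus)
  qed
  ultimately show "L = tilted_line S a u"
    using w by auto
qed

lemma pivot_line_diameter_circle:
  assumes "S + a \<in> diameter_circle S m" "a \<noteq> 0" "cmod u = 1"
  shows "pivot_line (diameter_circle S m) (S + a) (S + m * (of_real (Re u) * u)) = tilted_line S a u"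
proof (cases "S + m * (of_real (Re u) * u) = S + a")
  case True
  then show ?thesis
    using tangent_line_diameter_circle[OF assms] by (simp only: pivot_line_def simp_thms if_True)
next
  case False
  then have "affine hull {S + m * (of_real (Re u) * u), S + a} = tilted_line S a u"
    using tilted_line_two_points unit_point_in_tilted_line base_in_tilted_line assms by blast
  then show ?thesis
    using False by (simp add: pivot_line_def)
qed

text \<open>For \<open>m \<noteq> 0\<close> this is the spiral similarity about \<open>S\<close>
  with factor \<open>m' / m\<close>; around a closed chain of circles these factors multiply to
  1.\<close>

lemma pivot_map_diameter_circle:
  assumes "S + a \<in> diameter_circle S m" "S + a \<in> diameter_circle S m'" "a \<noteq> 0" "cmod u = 1"
  shows "pivot_map (diameter_circle S m) (diameter_circle S m') (S + a) (S + m * (of_real (Re u) * u))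
    = S + m' * (of_real (Re u) * u)"
proof -
  have "second_intersection (tilted_line S a u) (diameter_circle S m') (S + a)
    = S + m' * (of_real (Re u) * u)"
    unfolding second_intersection_def tilted_line_inter_diameter_circle[OF assms(2-4)]
    by (auto intro!: the_equality)
  then show ?thesis
    unfolding pivot_map_def pivot_line_diameter_circle[OF assms(1,3,4)] .
qed

section \<open>Collinearity and uniqueness of the circumcircle\<close>

lemma collinear_complex_iff:
  "collinear {x, y, z :: complex} \<longleftrightarrow> Im ((x - z) * cnj (y - z)) = 0"
proof -
  have "collinear {x, y, z} \<longleftrightarrow> collinear {x, z, y}"
    by (simp add: insert_commute)
  also have "\<dots> \<longleftrightarrow> collinear {0, x - z, y - z}"
    using collinear_3[of x z y] by (simp only: NO_MATCH_def simp_thms)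
  also have "\<dots> \<longleftrightarrow> Im ((y - z) / (x - z)) = 0"
    by (simp add: collinear_iff_Reals complex_is_Real_iff)
  also have "\<dots> \<longleftrightarrow> Im ((y - z) * cnj (x - z)) = 0"
    by (simp only: Im_complex_div_eq_0)
  also have "\<dots> \<longleftrightarrow> Im ((x - z) * cnj (y - z)) = 0"
    by simp argo
  finally show ?thesis .
qed

text \<open>Subtracting the circle equations leaves \<open>p \<bullet> k\<close> constant on the
  three points, where \<open>k\<close> joins the centres. So \<open>k\<close> is orthogonal to two
  independent vectors and vanishes.\<close>

lemma circle_through_three_points_unique:
  assumes "is_circle C" "is_circle C'" "\<not> collinear {x, y, z}" "{x, y, z} \<subseteq> C" "{x, y, z} \<subseteq> C'"
  shows "C = C'"
proof -
  obtain c r d s where C: "C = sphere c r" "C' = sphere d s"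
    using assms by (auto simp: is_circle_def)
  define k where "k = d - c"
  have eq: "2 * (p \<bullet> k) = d \<bullet> d - c \<bullet> c + r\<^sup>2 - s\<^sup>2" if "p \<in> {x, y, z}" for p
  proof -
    have "p \<in> C" "p \<in> C'"
      using assms that by blast+
    then have "dist c p = r" "dist d p = s"
      by (simp_all add: C)
    then have "(c - p) \<bullet> (c - p) = r\<^sup>2" "(d - p) \<bullet> (d - p) = s\<^sup>2"
      by (auto simp: dist_norm power2_norm_eq_inner)
    then show ?thesis
      unfolding k_def by (simp add: inner_commute algebra_simps inner_diff_left inner_diff_right)
  qed
  have "(x - z) \<bullet> k = 0" "(y - z) \<bullet> k = 0"
    using eq[of x] eq[of y] eq[of z] by (simp_all add: inner_diff_left)
  then have "Im ((x - z) * cnj (y - z)) * Re k = 0" "Im ((x - z) * cnj (y - z)) * Im k = 0"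
    by (simp_all add: inner_complex_def) algebra+
  then have "k = 0"
    using assms(3) by (simp add: collinear_complex_iff complex_eq_iff)
  then show ?thesis
    using assms(4,5) C by (auto simp: k_def)
qed

section \<open>Intersection of two lines with a common unit parameter\<close>

text \<open>Source of the circles in (i)-(iii): on the circle through \<open>S\<close>,
  \<open>S + a\<close> and \<open>S + b\<close>, the point with parameter \<open>u\<close> lies on
  both lines, whatever \<open>u\<close> is.\<close>

lemma tilted_lines_meet:
  assumes "a \<noteq> 0" "b \<noteq> 0" "\<not> collinear {S + a, S + b, S}"
  obtains m where "m \<noteq> 0" "S + a \<in> diameter_circle S m" "S + b \<in> diameter_circle S m"
    "\<And>u. cmod u = 1 \<Longrightarrow> tilted_line S a u \<inter> tilted_line S b u = {S + m * (of_real (Re u) * u)}"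
proof -
  have im: "Im (a / b) \<noteq> 0"
    using assms(3) by (simp add: collinear_complex_iff Im_complex_div_eq_0)
  \<comment> \<open>Every real \<open>r\<close> gives \<open>Re (m / a) = 1\<close>; this value
    gives \<open>Re (m / b) = 1\<close> too.\<close>
  define r where "r = (Re (a / b) - 1) / Im (a / b)"
  define m where "m = a * (1 + \<i> * of_real r)"
  have "Re (m / a) = 1"
    using assms by (simp add: m_def)
  then have ma: "S + a \<in> diameter_circle S m" and "m \<noteq> 0"
    using assms by (auto simp: diameter_circle_iff_Re)
  have "m / b = a / b * (1 + \<i> * of_real r)"
    by (simp add: m_def)
  then have "Re (m / b) = Re (a / b * (1 + \<i> * of_real r))"
    by (rule arg_cong)
  also have "\<dots> = Re (a / b) - r * Im (a / b)"
  proof -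
    have "Re (q * (1 + \<i> * of_real r)) = Re q - r * Im q" for q
      by simp
    then show ?thesis .
  qed
  also have "\<dots> = 1"
    using im by (simp add: r_def)
  finally have mb: "S + b \<in> diameter_circle S m"
    using assms by (simp add: diameter_circle_iff_Re)
  have "tilted_line S a u \<inter> tilted_line S b u = {S + m * (of_real (Re u) * u)}" if u: "cmod u = 1" for u
  proof (rule ccontr)
    \<comment> \<open>A second common point would make the lines equal, and then \<open>b\<close>
      would be a real multiple of \<open>a\<close>.\<close>
    assume neq: "tilted_line S a u \<inter> tilted_line S b u \<noteq> {S + m * (of_real (Re u) * u)}"
    have "S + m * (of_real (Re u) * u) \<in> tilted_line S a u \<inter> tilted_line S b u"
      using unit_point_in_tilted_line assms ma mb u by blast
    then obtain y where "y \<in> tilted_line S a u \<inter> tilted_line S b u" "y \<noteq> S + m * (of_real (Re u) * u)"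
      using neq by blast
    then have eq: "tilted_line S a u = tilted_line S b u"
      using tilted_line_two_points \<open>S + m * (of_real (Re u) * u) \<in> _\<close> by (metis IntE)
    have "S + b * (1 + \<i> * of_real 0 * u) \<in> tilted_line S a u"
      "S + b * (1 + \<i> * of_real 1 * u) \<in> tilted_line S a u"
      unfolding eq unfolding tilted_line_def by (rule rangeI)+
    then obtain r s where r: "S + b * (1 + \<i> * of_real 0 * u) = S + a * (1 + \<i> * of_real r * u)"
      and s: "S + b * (1 + \<i> * of_real 1 * u) = S + a * (1 + \<i> * of_real s * u)"
      unfolding tilted_line_def by blast
    have "b * (\<i> * u) = a * of_real (s - r) * (\<i> * u)"
      using r s by (simp add: algebra_simps)
    then have "b = a * of_real (s - r)"
      using u by auto
    then show False
      using assms by (simp add: collinear_complex_iff) 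
  qed
  then show thesis
    using that ma mb \<open>m \<noteq> 0\<close> by blast
qed

text \<open>Here \<open>a\<close> is a real multiple of \<open>b\<close>, so the lines are parallel
  or equal: with \<open>Y\<close> also \<open>Y + a * \<i> * u\<close> lies on both.\<close>

lemma tilted_lines_not_meet:
  assumes "a \<noteq> 0" "b \<noteq> 0" "u \<noteq> 0" "collinear {S + a, S + b, S}"
  shows "\<nexists>Y. tilted_line S a u \<inter> tilted_line S b u = {Y}"
proof
  assume "\<exists>Y. tilted_line S a u \<inter> tilted_line S b u = {Y}"
  then obtain Y where Y: "tilted_line S a u \<inter> tilted_line S b u = {Y}"
    by blast
  then have "Y \<in> tilted_line S a u" "Y \<in> tilted_line S b u"
    by blast+
  then obtain r s where r: "Y = S + a * (1 + \<i> * of_real r * u)" and s: "Y = S + b * (1 + \<i> * of_real s * u)"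
    unfolding tilted_line_def by blast
  have "Im (a / b) = 0"
    using assms by (simp add: collinear_complex_iff Im_complex_div_eq_0)
  then obtain c where "a / b = of_real c"
    using complex_is_Real_iff Reals_cases by metis
  then have c: "a = b * of_real c"
    using assms by (simp add: field_simps)
  have "Y + a * \<i> * u = S + a * (1 + \<i> * of_real (r + 1) * u)"
    by (simp add: r algebra_simps)
  moreover have "Y + a * \<i> * u = S + b * (1 + \<i> * of_real (s + c) * u)"
    by (simp add: s c algebra_simps)
  ultimately have "Y + a * \<i> * u \<in> tilted_line S a u \<inter> tilted_line S b u"
    unfolding tilted_line_def by blast
  then show False
    using Y assms by auto
qed

section \<open>Coordinates of the quadrilateral as tangents of a parabola\<close>

lemma form_triangle_not_collinear:
  assumes "form_triangle l m n" "l \<inter> m = {x}" "m \<inter> n = {y}" "n \<inter> l = {z}"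
  shows "\<not> collinear {x, y, z}"
proof -
  obtain a b c where abc: "\<not> collinear {a, b, c}" "l = affine hull {b, c}" "m = affine hull {c, a}"
    "n = affine hull {a, b}"
    using assms(1) by (auto simp: form_triangle_def)
  then have "c \<in> l \<inter> m" "a \<in> m \<inter> n" "b \<in> n \<inter> l"
    by (simp_all add: hull_inc)
  then have "c = x" "a = y" "b = z"
    using assms by blast+
  then show ?thesis
    using abc(1) by (simp add: insert_commute)
qed

lemma form_triangle_collinear:
  assumes "form_triangle l m n"
  shows "collinear l"
  using assms by (auto simp: form_triangle_def collinear_affine_hull_collinear)

lemma collinear_affine_combination:
  fixes x y z :: complex
  assumes "collinear {x, y, z}" "x \<noteq> z"
  obtains c :: real where "y = x + of_real c * (z - x)"
proof -
  obtain u where "y = u *\<^sub>R x + (1 - u) *\<^sub>R z"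
    using assms by (auto simp: collinear_3_expand)
  then have "y = x + of_real (1 - u) * (z - x)"
    by (simp add: scaleR_conv_of_real algebra_simps)
  then show thesis
    using that by blast
qed

lemma real_combination_unique:
  fixes d e :: complex and x y x' y' :: real
  assumes "of_real x * e + of_real y * d = of_real x' * e + of_real y' * d" "Im (e * cnj d) \<noteq> 0"
  shows "x = x' \<and> y = y'"
proof -
  have "x * Re e + y * Re d = x' * Re e + y' * Re d" "x * Im e + y * Im d = x' * Im e + y' * Im d"
    using assms(1) by (simp_all add: complex_eq_iff)
  then have "(x - x') * Im (e * cnj d) = 0" "(y - y') * Im (e * cnj d) = 0"
    by simp_all algebra+
  then show ?thesis
    using assms(2) by simp
qed

text \<open>Supplies the focus and the tangent parameters: \<open>t1\<close>, \<open>t2\<close>,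
  \<open>t3\<close>, \<open>t4\<close> belong to the lines \<open>a4 a1 Q\<close>,
  \<open>a1 a2 P\<close>, \<open>a2 a3 Q\<close>, \<open>a3 a4 P\<close>, and a vertex is the
  product of the factors of its two lines.\<close>

lemma quadrilateral_coordinates:
  fixes a1 a2 a3 a4 P Q :: complex
  assumes "collinear {a4, a1, Q}" "collinear {a1, a2, P}" "collinear {a2, a3, Q}" "collinear {a3, a4, P}"
    and "\<not> collinear {a4, a1, P}" "\<not> collinear {a1, a2, Q}" "\<not> collinear {a2, a3, P}"
      "\<not> collinear {a3, a4, Q}"
  obtains S w t1 t2 t3 t4 where "w \<noteq> 0" "distinct [t1, t2, t3, t4 :: real]"
    "a1 = S + w * ((1 + \<i> * of_real t1) * (1 + \<i> * of_real t2))"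
    "a2 = S + w * ((1 + \<i> * of_real t2) * (1 + \<i> * of_real t3))"
    "a3 = S + w * ((1 + \<i> * of_real t3) * (1 + \<i> * of_real t4))"
    "a4 = S + w * ((1 + \<i> * of_real t4) * (1 + \<i> * of_real t1))"
    "P = S + w * ((1 + \<i> * of_real t2) * (1 + \<i> * of_real t4))"
    "Q = S + w * ((1 + \<i> * of_real t1) * (1 + \<i> * of_real t3))"
proof -
  \<comment> \<open>Affine frame at \<open>a1\<close>. The ratios \<open>\<beta>\<close> and
    \<open>\<alpha>\<close> will locate \<open>a2\<close> and \<open>a4\<close>; \<open>a3\<close>
    is then forced as the intersection of the other two sides.\<close>
  define e where "e = P - a1"
  define d where "d = Q - a1"
  have P: "P = a1 + e" and Q: "Q = a1 + d"
    by (simp_all add: e_def d_def)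
  have neq: "a1 \<noteq> P" "a1 \<noteq> Q" "a4 \<noteq> P" "a2 \<noteq> Q" "a1 \<noteq> a2" "a1 \<noteq> a4" "a2 \<noteq> P" "a4 \<noteq> Q"
    using assms(5-8) by (auto simp: insert_commute)
  obtain \<beta> where a2: "a2 = a1 + of_real \<beta> * e"
    using collinear_affine_combination[OF assms(2) neq(1)] unfolding e_def by blast
  obtain \<alpha> where a4: "a4 = a1 + of_real \<alpha> * d"
    using collinear_affine_combination[of a1 a4 Q] assms(1) neq(2) unfolding d_def
    by (metis insert_commute)
  obtain \<nu> where "a3 = P + of_real \<nu> * (a4 - P)"
    using collinear_affine_combination[of P a3 a4] assms(4) neq(3) by (metis insert_commute)
  then have a3: "a3 = a1 + (of_real (1 - \<nu>) * e + of_real (\<nu> * \<alpha>) * d)"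
    by (simp add: P a4 algebra_simps)
  obtain \<mu> where "a3 = Q + of_real \<mu> * (a2 - Q)"
    using collinear_affine_combination[of Q a3 a2] assms(3) neq(4) by (metis insert_commute)
  then have a3': "a3 = a1 + (of_real (\<mu> * \<beta>) * e + of_real (1 - \<mu>) * d)"
    by (simp add: Q a2 algebra_simps)
  have indep: "Im (e * cnj d) \<noteq> 0"
  proof
    assume "Im (e * cnj d) = 0"
    then have "Im ((a1 - Q) * cnj (a2 - Q)) = 0"
      unfolding Q a2 by simp algebra
    then show False
      using assms(6) by (simp add: collinear_complex_iff)
  qed
  have "1 - \<nu> = \<mu> * \<beta> \<and> \<nu> * \<alpha> = 1 - \<mu>"
    using a3 a3' by (intro real_combination_unique[OF _ indep]) simp
  then have \<nu>_eq: "\<nu> * (\<alpha> * \<beta> - 1) = \<beta> - 1"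
    by algebra
  have ne: "\<alpha> \<noteq> 0" "\<beta> \<noteq> 0" "\<alpha> \<noteq> 1" "\<beta> \<noteq> 1"
    using neq a2 a4 P Q by auto
  \<comment> \<open>\<open>\<alpha> * \<beta> = 1\<close>, the case of parallel lines
    \<open>a4 P\<close> and \<open>a2 Q\<close>, would force \<open>\<beta> = 1\<close>.\<close>
  then have k: "\<alpha> * \<beta> - 1 \<noteq> 0"
    using \<nu>_eq by auto
  \<comment> \<open>\<open>N = P + Q - a2 - a4\<close> is the coefficient of \<open>S - a1\<close>
    in \<open>(a2 - S) (a4 - S) = (P - S) (Q - S)\<close>, where the squares cancel.
    \<open>p = a2 - Q\<close> and \<open>p + N = P - a4\<close> are directions of the two sides
    through \<open>a3\<close>.\<close>
  define N where "N = of_real (1 - \<beta>) * e + of_real (1 - \<alpha>) * d"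
  define p where "p = of_real \<beta> * e - d"
  have "Im (p * cnj N) = (1 - \<alpha> * \<beta>) * Im (e * cnj d)" 
    unfolding p_def N_def by (simp add: algebra_simps)
  then have pN: "Im (p * cnj N) \<noteq> 0"
    using k indep by simp
  then have "N \<noteq> 0"
    by auto
  define \<rho> where "\<rho> = p / N"
  have I: "Im \<rho> \<noteq> 0"
    using pN by (simp add: \<rho>_def Im_complex_div_eq_0)
  \<comment> \<open>Division by \<open>N\<close> moves the points \<open>p + s N\<close> to the
    horizontal line at height \<open>Im \<rho>\<close>; dividing by \<open>\<i> * Im \<rho>\<close>
    puts them on real part 1, with imaginary part \<open>t s\<close>.\<close>
  define \<kappa> where "\<kappa> = \<i> * (N * of_real (Im \<rho>))"
  define t where "t s = - (s + Re \<rho>) / Im \<rho>" for s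
  have "\<kappa> \<noteq> 0"
    using I \<open>N \<noteq> 0\<close> by (simp add: \<kappa>_def)
  have pt: "p + of_real s * N = \<kappa> * (1 + \<i> * of_real (t s))" for s
  proof -
    have "p = \<rho> * N"
      using \<open>N \<noteq> 0\<close> by (simp add: \<rho>_def)
    then have "p + of_real s * N = N * (\<rho> + of_real s)"
      by (simp add: algebra_simps)
    also have "\<rho> + of_real s = \<i> * of_real (Im \<rho>) * (1 + \<i> * of_real (t s))"
      using I by (simp add: complex_eq_iff t_def)
    finally show ?thesis
      by (simp add: \<kappa>_def)
  qed
  \<comment> \<open>\<open>s1\<close> cancels the \<open>e\<close> component of
    \<open>p + s N\<close> and \<open>s2\<close> the \<open>d\<close> component, giving the
    directions of the two sides through \<open>a1\<close>.\<close>
  define s1 where "s1 = - \<beta> / (1 - \<beta>)"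
  define s2 where "s2 = 1 / (1 - \<alpha>)"
  \<comment> \<open>\<open>S\<close> solves \<open>(a\<^sub>1 - S) (a\<^sub>3 - S) = (a\<^sub>2 - S) (a\<^sub>4 - S) = (P - S) (Q - S)\<close>; the points
    \<open>p + s N\<close> for \<open>s = s\<^sub>1, s\<^sub>2, 0, 1\<close> are then, up to the factor \<open>\<kappa>\<close>, the numbers \<open>1 + \<i> t\<^sub>j\<close>.\<close>
  define A B where "A = complex_of_real \<alpha>" and "B = complex_of_real \<beta>"
  have AB: "A \<noteq> 1" "B \<noteq> 1" "A * B - 1 \<noteq> 0"
    using ne k by (auto simp: A_def B_def simp flip: of_real_mult)
  \<comment> \<open>\<open>W\<close> is dictated by
    \<open>a1 - S = W (p + s1 N) (p + s2 N)\<close>.\<close>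
  define W where "W = (1 - B) * (A - 1) / (A * B - 1) / N"
  define S where "S = a1 + e * d * (1 - A * B) / N"
  have N: "N = (1 - B) * e + (1 - A) * d" and p: "p = B * e - d"
    by (simp_all add: N_def p_def A_def B_def)
  have sB: "of_real s1 = - B / (1 - B)" and sA: "of_real s2 = 1 / (1 - A)"
    by (simp_all add: s1_def s2_def A_def B_def)
  have p1: "p + of_real s1 * N = (A * B - 1) / (1 - B) * d"
    unfolding sB using AB by (simp add: divide_simps) (simp add: N p algebra_simps)
  have p2: "p + of_real s2 * N = (A * B - 1) / (A - 1) * e"
    unfolding sA using AB by (simp add: divide_simps) (simp add: N p algebra_simps)
  have p3: "p + of_real 0 * N = p"
    by simp
  have p4: "p + of_real 1 * N = e - A * d"
    by (simp add: N p algebra_simps)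
  have W1: "W * ((A * B - 1) / (1 - B) * d * z) = (A - 1) * d * z / N" for z
    using AB by (simp add: W_def)
  have W2: "W * ((A * B - 1) / (A - 1) * e * z) = (1 - B) * e * z / N" for z
    using AB by (simp add: W_def)
  \<comment> \<open>Clears the common denominator \<open>N\<close> from the vertex formulas.\<close>
  have add_N: "a1 + y = S + z / N" if "y * N = e * d * (1 - A * B) + z" for y z
    using that \<open>N \<noteq> 0\<close> by (simp add: S_def field_simps)
  have "a1 + 0 = S + W * ((p + of_real s1 * N) * (p + of_real s2 * N))"
    unfolding p1 p2 W1 using AB by (intro add_N) (simp add: field_simps)
  then have c1: "a1 = S + W * ((p + of_real s1 * N) * (p + of_real s2 * N))"
    by simp
  have c2: "a2 = S + W * ((p + of_real s2 * N) * (p + of_real 0 * N))"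
    unfolding p2 p3 W2 a2 by (intro add_N) (simp add: N p algebra_simps flip: A_def B_def)
  have "W * ((p + of_real s1 * N) * (p + of_real 1 * N)) = (A - 1) * d * (e - A * d) / N"
    unfolding p1 p4 W1 ..
  moreover have "a4 = S + (A - 1) * d * (e - A * d) / N"
    unfolding a4 by (intro add_N) (simp add: N p algebra_simps flip: A_def B_def)
  ultimately have c4: "a4 = S + W * ((p + of_real 1 * N) * (p + of_real s1 * N))"
    by (simp only: mult.commute)
  have cP: "P = S + W * ((p + of_real s2 * N) * (p + of_real 1 * N))"
    unfolding p2 p4 W2 P by (intro add_N) (simp add: N algebra_simps)
  have cQ: "Q = S + W * ((p + of_real s1 * N) * (p + of_real 0 * N))"
    unfolding p1 p3 W1 Q by (intro add_N) (simp add: N p algebra_simps)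
  have "\<nu> = (\<beta> - 1) / (\<alpha> * \<beta> - 1)"
    using \<nu>_eq k by (simp add: field_simps)
  then have of_real_\<nu>: "complex_of_real \<nu> = (B - 1) / (A * B - 1)"
    by (simp add: A_def B_def)
  have a3_eq: "a3 = a1 + ((1 - (B - 1) / (A * B - 1)) * e + (B - 1) / (A * B - 1) * A * d)"
    using a3 by (simp add: of_real_\<nu> flip: A_def)
  have c3: "a3 = S + W * ((p + of_real 0 * N) * (p + of_real 1 * N))"
  proof -
    have "W * (p * (e - A * d)) = (1 - B) * (A - 1) / (A * B - 1) * p * (e - A * d) / N"
      by (simp add: W_def)
    moreover have "a3 = S + (1 - B) * (A - 1) / (A * B - 1) * p * (e - A * d) / N"
      unfolding a3_eq using AB
      by (intro add_N) (simp add: divide_simps, simp add: N p algebra_simps)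
    ultimately show ?thesis
      unfolding p3 p4 by simp
  qed
  have inj: "t s \<noteq> t s'" if "s \<noteq> s'" for s s'
    using that I by (simp add: t_def divide_simps)
  \<comment> \<open>\<open>s1 = s2\<close> would mean \<open>\<alpha> * \<beta> = 1\<close>.\<close>
  have "s1 \<noteq> 0" "s1 \<noteq> 1" "s2 \<noteq> 0" "s2 \<noteq> 1" "s1 \<noteq> s2"
    using ne k by (auto simp: s1_def s2_def divide_simps algebra_simps)
  then have dist: "distinct [t s1, t s2, t 0, t 1]"
    using inj by auto
  have fold_w: "W * ((\<kappa> * x) * (\<kappa> * y)) = (W * \<kappa>\<^sup>2) * (x * y)" for x y
    by (simp add: power2_eq_square)
  have "W * \<kappa>\<^sup>2 \<noteq> 0"
    using \<open>\<kappa> \<noteq> 0\<close> \<open>N \<noteq> 0\<close> AB by (simp add: W_def)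
  from that[OF this dist c1[unfolded pt fold_w] c2[unfolded pt fold_w] c3[unfolded pt fold_w]
      c4[unfolded pt fold_w] cP[unfolded pt fold_w] cQ[unfolded pt fold_w]]
  show thesis .
qed

text \<open>A common point makes every \<open>t\<^sub>j\<close> a root of the same monic quadratic.\<close>

lemma diameter_circles_no_common_point:
  fixes t1 t2 t3 :: real
  assumes "distinct [t1, t2, t3]" "z \<noteq> 0"
    and "S + z \<in> diameter_circle S (g / (1 + \<i> * of_real t1))"
      "S + z \<in> diameter_circle S (g / (1 + \<i> * of_real t2))"
      "S + z \<in> diameter_circle S (g / (1 + \<i> * of_real t3))"
  shows False
proof -
  have eq: "Re (g / z) + t * Im (g / z) = 1 + t\<^sup>2"
    if "S + z \<in> diameter_circle S (g / (1 + \<i> * of_real t))" for t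
  proof -
    have "Re (q / (1 + \<i> * of_real t)) = (Re q + t * Im q) / (1 + t\<^sup>2)" for q
      by (simp add: Re_divide mult.commute)
    moreover have "Re (g / z / (1 + \<i> * of_real t)) = 1"
      using that assms(2) by (simp add: diameter_circle_iff_Re divide_divide_eq_left mult.commute)
    moreover have "1 + t\<^sup>2 \<noteq> 0"
      by (metis add_pos_nonneg less_irrefl zero_le_power2 zero_less_one)
    ultimately show ?thesis
      by (metis nonzero_divide_eq_eq mult_1)
  qed
  have "(t1 - t2) * (Im (g / z) - t1 - t2) = 0" "(t1 - t3) * (Im (g / z) - t1 - t3) = 0"
    using assms(3-5)[THEN eq] by (simp_all add: power2_eq_square algebra_simps)
  then show False
    using assms(1) by simp
qed

text \<open>Each of (i)-(iii) is split by collinearity: if the two fixed points and \<open>S\<close>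
  are collinear, no circle passes through them, and the two moving lines are parallel or equal for
  every admissible \<open>x\<close>.\<close>

theorem corollary17:
  fixes l C :: "4 \<Rightarrow> complex set"
    and A :: "4 \<Rightarrow> complex"
    and P Q :: complex
    and \<phi> :: "4 \<Rightarrow> complex \<Rightarrow> complex"
    and X :: "4 \<Rightarrow> complex \<Rightarrow> complex"
    and ell :: "4 \<Rightarrow> complex \<Rightarrow> complex set"
  assumes triangle: "\<And>i. form_triangle (l (i - 1)) (l i) (l (i + 1))"
    and circumcircle: "\<And>i. is_circumcircle (l (i - 1)) (l i) (l (i + 1)) (C i)"
    and A: "\<And>i. l i \<inter> l (i + 1) = {A i}"
    and P: "l 2 \<inter> l 4 = {P}"
    and Q: "l 1 \<inter> l 3 = {Q}"
    and \<phi>: "\<And>i. \<phi> i = pivot_map (C i) (C (i + 1)) (A i)"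
    and X: "\<And>x. X 1 x = x" "\<And>x. X 2 x = \<phi> 1 (X 1 x)"
           "\<And>x. X 3 x = \<phi> 2 (X 2 x)" "\<And>x. X 4 x = \<phi> 3 (X 3 x)"
    and ell: "\<And>i x. ell i x = pivot_line (C i) (A i) (X i x)"
  shows "(\<forall>i. \<phi> i ` C i \<subseteq> C (i + 1)) \<and>
    (\<forall>x\<in>C 1. (\<phi> 4 \<circ> \<phi> 3 \<circ> \<phi> 2 \<circ> \<phi> 1) x = x) \<and>
    (\<forall>x\<in>C 1. \<forall>i. is_line (ell i x) \<and> {X i x, A i, X (i + 1) x} \<subseteq> ell i x) \<and>
    (\<exists>S. (\<Inter>i. C i) = {S} \<and>
      \<comment> \<open>(i)\<close>
      (\<not> collinear {A 1, A 3, S} \<longrightarrow>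
        (\<exists>C13. is_circle C13 \<and> {A 1, A 3, S} \<subseteq> C13 \<and>
          (\<forall>x\<in>C 1. \<exists>X13\<in>C13. ell 1 x \<inter> ell 3 x = {X13}))) \<and>
      (collinear {A 1, A 3, S} \<longrightarrow>
        (\<forall>x\<in>C 1. \<nexists>X13. ell 1 x \<inter> ell 3 x = {X13})) \<and>
      \<comment> \<open>(ii)\<close>
      (\<not> collinear {A 2, A 4, S} \<longrightarrow>
        (\<exists>C24. is_circle C24 \<and> {A 2, A 4, S} \<subseteq> C24 \<and>
          (\<forall>x\<in>C 1. \<exists>X24\<in>C24. ell 2 x \<inter> ell 4 x = {X24}))) \<and>
      (collinear {A 2, A 4, S} \<longrightarrow>
        (\<forall>x\<in>C 1. \<nexists>X24. ell 2 x \<inter> ell 4 x = {X24})) \<and>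
      \<comment> \<open>(iii); all \<open>X\<^sub>i\<close> coincide with \<open>S\<close> if \<open>X\<^sub>1 = S\<close>\<close>
      (\<forall>x\<in>C 1 - {S}. X 1 x \<noteq> X 3 x \<and> X 2 x \<noteq> X 4 x) \<and>
      (\<not> collinear {P, Q, S} \<longrightarrow>
        (\<exists>C0. is_circle C0 \<and> {P, Q, S} \<subseteq> C0 \<and>
          (\<forall>x\<in>C 1 - {S}. \<exists>Y\<in>C0.
            affine hull {X 1 x, X 3 x} \<inter> affine hull {X 2 x, X 4 x} = {Y}))) \<and>
      (collinear {P, Q, S} \<longrightarrow>
        (\<forall>x\<in>C 1 - {S}. \<nexists>Y.
            affine hull {X 1 x, X 3 x} \<inter> affine hull {X 2 x, X 4 x} = {Y})) \<and>
      \<comment> \<open>(iv)\<close>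
      (\<forall>x\<in>C 1. \<exists>D. is_circle D \<and> {X 1 x, X 2 x, X 3 x, X 4 x, S} \<subseteq> D) \<and>
      \<comment> \<open>(v)\<close>
      (\<forall>x\<in>C 1. collinear {X 1 x, X 3 x, P} \<and> collinear {X 2 x, X 4 x, Q}))"
proof -

  \<comment> \<open>Coordinates of the vertices and the four circles\<close>
  have [simp]: "(5::4) = 1" "(6::4) = 2" "(0::4) = 4"
    by simp_all
  have collinear_l: "collinear (l i)" for i
    using form_triangle_collinear[OF triangle[of "i + 1"]] by simp
  have on_l: "A 4 \<in> l 1" "A 1 \<in> l 1" "Q \<in> l 1" "A 1 \<in> l 2" "A 2 \<in> l 2" "P \<in> l 2"
    "A 2 \<in> l 3" "A 3 \<in> l 3" "Q \<in> l 3" "A 3 \<in> l 4" "A 4 \<in> l 4" "P \<in> l 4"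
    using A[of 1] A[of 2] A[of 3] A[of 4] P Q by auto
  have not_col: "\<not> collinear {A 4, A 1, P}" "\<not> collinear {A 1, A 2, Q}"
    "\<not> collinear {A 2, A 3, P}" "\<not> collinear {A 3, A 4, Q}"
    using form_triangle_not_collinear[of "l 4" "l 1" "l 2" "A 4" "A 1" P] triangle[of 1]
      form_triangle_not_collinear[of "l 1" "l 2" "l 3" "A 1" "A 2" Q] triangle[of 2]
      form_triangle_not_collinear[of "l 2" "l 3" "l 4" "A 2" "A 3" P] triangle[of 3]
      form_triangle_not_collinear[of "l 3" "l 4" "l 1" "A 3" "A 4" Q] triangle[of 4]
      A[of 1] A[of 2] A[of 3] A[of 4] P Q
    by (simp_all add: Int_commute)
  have col: "collinear {A 4, A 1, Q}" "collinear {A 1, A 2, P}" "collinear {A 2, A 3, Q}"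
    "collinear {A 3, A 4, P}"
    using collinear_subset[OF collinear_l] on_l by (metis empty_subsetI insert_subset)+
  obtain S w t1 t2 t3 t4 where "w \<noteq> 0" and dist: "distinct [t1, t2, t3, t4]"
    and A_eqs: "A 1 = S + w * ((1 + \<i> * of_real t1) * (1 + \<i> * of_real t2))"
    "A 2 = S + w * ((1 + \<i> * of_real t2) * (1 + \<i> * of_real t3))"
    "A 3 = S + w * ((1 + \<i> * of_real t3) * (1 + \<i> * of_real t4))"
    "A 4 = S + w * ((1 + \<i> * of_real t4) * (1 + \<i> * of_real t1))"
    and PQ_eqs: "P = S + w * ((1 + \<i> * of_real t2) * (1 + \<i> * of_real t4))"
    "Q = S + w * ((1 + \<i> * of_real t1) * (1 + \<i> * of_real t3))"
    by (rule quadrilateral_coordinates[OF col not_col])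
  define t where "t i = (if i = 1 then t1 else if i = 2 then t2 else if i = 3 then t3 else t4)"
    for i :: 4
  define p where "p i = 1 + \<i> * of_real (t i)" for i
  define g where "g = w * (p 1 * p 2 * p 3 * p 4)"
  \<comment> \<open>Indices are of type \<open>4\<close>, so \<open>i + 2\<close> is cyclic; \<open>m i\<close> omits the line opposite to \<open>l i\<close>.\<close>
  define m where "m i = g / p (i + 2)" for i
  define a where "a i = w * (p i * p (i + 1))" for i
  \<comment> \<open>\<open>S + b i\<close> is the intersection of the opposite lines
    \<open>l i\<close> and \<open>l (i + 2)\<close>: \<open>Q\<close> for odd \<open>i\<close>,
    \<open>P\<close> for even \<open>i\<close>.\<close>
  define b where "b i = w * (p i * p (i + 2))" for i
  have t_eqs: "t 1 = t1" "t 2 = t2" "t 3 = t3" "t 4 = t4"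
    by (simp_all add: t_def)
  have p_nz: "p i \<noteq> 0" and Re_p: "Re (p i) = 1" for i
    by (auto simp: p_def complex_eq_iff)
  have g_nz: "g \<noteq> 0"
    using \<open>w \<noteq> 0\<close> p_nz by (simp add: g_def)
  have m_nz: "m i \<noteq> 0" and a_nz: "a i \<noteq> 0" and b_nz: "b i \<noteq> 0" for i
    using \<open>w \<noteq> 0\<close> p_nz g_nz by (simp_all add: m_def a_def b_def)
  have "\<forall>i. A i = S + a i"
    unfolding forall_4 by (simp add: A_eqs a_def p_def t_eqs)
  then have A_eq: "A i = S + a i" for i ..
  have P_eq: "P = S + b 2" and Q_eq: "Q = S + b 1"
    by (simp_all add: PQ_eqs b_def p_def t_eqs)
  have m_eqs: "m 1 = w * (p 4 * p 1 * p 2)" "m 2 = w * (p 1 * p 2 * p 3)"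
    "m 3 = w * (p 2 * p 3 * p 4)" "m 4 = w * (p 3 * p 4 * p 1)"
    using p_nz by (simp_all add: m_def g_def)
  \<comment> \<open>By the Thales criterion, all incidences with circles reduce to
    \<open>Re (p i) = 1\<close>.\<close>
  have circle_memI: "S + z \<in> diameter_circle S (z * p i)" if "z \<noteq> 0" for z i
    using that Re_p by (simp add: diameter_circle_iff_Re)
  have "\<forall>i. S + a i \<in> diameter_circle S (m i) \<and> S + a i \<in> diameter_circle S (m (i + 1))"
    unfolding forall_4
    using circle_memI[OF a_nz, of 1 4] circle_memI[OF a_nz, of 1 3]
      circle_memI[OF a_nz, of 2 1] circle_memI[OF a_nz, of 2 4]
      circle_memI[OF a_nz, of 3 2] circle_memI[OF a_nz, of 3 1]
      circle_memI[OF a_nz, of 4 3] circle_memI[OF a_nz, of 4 2]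
    by (simp add: a_def m_eqs mult_ac)
  then have a_on: "S + a i \<in> diameter_circle S (m i)" "S + a i \<in> diameter_circle S (m (i + 1))" for i
    by blast+
  have b_on: "S + b 2 \<in> diameter_circle S (m 1)" "S + b 2 \<in> diameter_circle S (m 3)"
    "S + b 1 \<in> diameter_circle S (m 2)" "S + b 1 \<in> diameter_circle S (m 4)"
    using circle_memI[OF b_nz, of 2 1] circle_memI[OF b_nz, of 2 3]
      circle_memI[OF b_nz, of 1 2] circle_memI[OF b_nz, of 1 4]
    by (simp_all add: b_def m_eqs mult_ac)
  have C_circle: "is_circle (C i)" and C_mem: "A i \<in> C i" "A (i - 1) \<in> C i"
    and C_mem': "l (i + 1) \<inter> l (i - 1) \<subseteq> C i" for i
    using circumcircle[of i] A[of i] A[of "i - 1"] by (auto simp: is_circumcircle_def)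
  have C_PQ: "P \<in> C 1" "P \<in> C 3" "Q \<in> C 2" "Q \<in> C 4"
    using C_mem'[of 1] C_mem'[of 2] C_mem'[of 3] C_mem'[of 4] on_l by auto
  \<comment> \<open>The two circles share the triangle vertices \<open>A (i - 1)\<close>,
    \<open>A i\<close> and \<open>P\<close> (odd \<open>i\<close>) or \<open>Q\<close> (even
    \<open>i\<close>).\<close>
  have "\<forall>i. C i = diameter_circle S (m i)"
    unfolding forall_4
    using circle_through_three_points_unique[OF C_circle[of 1] is_circle_diameter_circle[OF m_nz[of 1]] not_col(1)]
      circle_through_three_points_unique[OF C_circle[of 2] is_circle_diameter_circle[OF m_nz[of 2]] not_col(2)]
      circle_through_three_points_unique[OF C_circle[of 3] is_circle_diameter_circle[OF m_nz[of 3]] not_col(3)]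
      circle_through_three_points_unique[OF C_circle[of 4] is_circle_diameter_circle[OF m_nz[of 4]] not_col(4)]
      C_mem[of 1] C_mem[of 2] C_mem[of 3] C_mem[of 4] C_PQ b_on
      a_on[of 1] a_on[of 2] a_on[of 3] a_on[of 4]
    by (simp add: A_eq P_eq Q_eq)
  then have C_eq: "C i = diameter_circle S (m i)" for i ..

  \<comment> \<open>Pivot maps, side lines and diagonals in coordinates\<close>
  define v where "v u = of_real (Re u) * u" for u
  have C_iff: "z \<in> C i \<longleftrightarrow> (\<exists>u. cmod u = 1 \<and> z = S + m i * v u)" for z i
    by (simp add: C_eq diameter_circle_iff_unit v_def)
  have \<phi>_eq: "\<phi> i (S + m i * v u) = S + m (i + 1) * v u" if "cmod u = 1" for i u
    unfolding \<phi> C_eq A_eq v_def by (rule pivot_map_diameter_circle[OF a_on a_nz that])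
  have X_eq: "X i (S + m 1 * v u) = S + m i * v u" if u: "cmod u = 1" for i u
  proof -
    have "\<forall>i. X i (S + m 1 * v u) = S + m i * v u"
      unfolding forall_4 using \<phi>_eq[OF u, of 1] \<phi>_eq[OF u, of 2] \<phi>_eq[OF u, of 3] by (simp add: X)
    then show ?thesis ..
  qed
  have ell_eq: "ell i (S + m 1 * v u) = tilted_line S (a i) u" if u: "cmod u = 1" for i u
    unfolding ell X_eq[OF u] C_eq A_eq unfolding v_def
    by (rule pivot_line_diameter_circle[OF a_on(1) a_nz u])
  have on_line: "S + m i * v u \<in> tilted_line S c u"
    if "S + c \<in> diameter_circle S (m i)" "c \<noteq> 0" "cmod u = 1" for i c u
    unfolding v_def by (rule unit_point_in_tilted_line[OF that])
  have m_neq: "m 1 \<noteq> m 3" "m 2 \<noteq> m 4"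
    using dist g_nz p_nz by (simp_all add: m_def divide_simps) (simp_all add: p_def t_eqs)
  have v_nz: "v u \<noteq> 0" if "S + m 1 * v u \<noteq> S" for u
    using that by auto
  \<comment> \<open>\<open>P\<close> lies on \<open>C 1\<close> and \<open>C 3\<close>, so the
    points with parameter \<open>u\<close> on these circles lie on one tilted line through
    \<open>P\<close>; \<open>v u \<noteq> 0\<close> keeps them distinct. Likewise for
    \<open>Q\<close>, \<open>C 2\<close> and \<open>C 4\<close>.\<close>
  have hull_13: "affine hull {S + m 1 * v u, S + m 3 * v u} = tilted_line S (b 2) u"
    and hull_24: "affine hull {S + m 2 * v u, S + m 4 * v u} = tilted_line S (b 1) u"
    if u: "cmod u = 1" "v u \<noteq> 0" for u
    using m_neq u(2)
    by (intro tilted_line_two_points on_line[OF _ b_nz u(1)] b_on; simp)+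

  \<comment> \<open>Closure, the Steiner point and the assertions (i)-(v)\<close>
  have maps: "\<forall>i. \<phi> i ` C i \<subseteq> C (i + 1)"
    unfolding image_subset_iff Ball_def C_iff using \<phi>_eq by metis
  have closes: "\<forall>x\<in>C 1. (\<phi> 4 \<circ> \<phi> 3 \<circ> \<phi> 2 \<circ> \<phi> 1) x = x"
  proof
    fix x assume "x \<in> C 1"
    then obtain u where u: "cmod u = 1" "x = S + m 1 * v u"
      by (auto simp: C_iff)
    show "(\<phi> 4 \<circ> \<phi> 3 \<circ> \<phi> 2 \<circ> \<phi> 1) x = x"
      using \<phi>_eq[OF u(1), of 1] \<phi>_eq[OF u(1), of 2] \<phi>_eq[OF u(1), of 3] \<phi>_eq[OF u(1), of 4]
      by (simp add: u(2))
  qed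
  have lines: "\<forall>x\<in>C 1. \<forall>i. is_line (ell i x) \<and> {X i x, A i, X (i + 1) x} \<subseteq> ell i x"
  proof (intro ballI allI)
    fix x i assume "x \<in> C 1"
    then obtain u where u: "cmod u = 1" "x = S + m 1 * v u"
      by (auto simp: C_iff)
    then have "u \<noteq> 0"
      by auto
    show "is_line (ell i x) \<and> {X i x, A i, X (i + 1) x} \<subseteq> ell i x"
      unfolding u(2) ell_eq[OF u(1)] X_eq[OF u(1)] A_eq
      using is_line_tilted_line[OF a_nz \<open>u \<noteq> 0\<close>] base_in_tilted_line
        on_line[OF a_on(1) a_nz u(1)] on_line[OF a_on(2) a_nz u(1)]
      by simp
  qed
  have steiner: "(\<Inter>i. C i) = {S}"
  proof
    show "{S} \<subseteq> (\<Inter>i. C i)"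
      by (auto simp: C_eq endpoint_in_diameter_circle)
    show "(\<Inter>i. C i) \<subseteq> {S}"
    proof
      fix z assume "z \<in> (\<Inter>i. C i)"
      then have z: "S + (z - S) \<in> diameter_circle S (m i)" for i
        by (auto simp: C_eq)
      have "z - S = 0"
      proof (rule ccontr)
        assume "z - S \<noteq> 0"
        \<comment> \<open>The circles 3, 4, 1 have \<open>m\<close> equal to \<open>g\<close>
          divided by \<open>p 1\<close>, \<open>p 2\<close>, \<open>p 3\<close>.\<close>
        then show False
          using diameter_circles_no_common_point[of t1 t2 t3 "z - S" S g] dist z[of 3] z[of 4] z[of 1]
          by (simp add: m_def p_def t_eqs)
      qed
      then show "z \<in> {S}"
        by simp
    qed
  qed
  \<comment> \<open>Gives (i) for the indices 1, 3 and (ii) for 2, 4; the circle does not depend on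
    the parameter \<open>u\<close> of \<open>x\<close>.\<close>
  have opposite: "(\<not> collinear {A i, A j, S} \<longrightarrow>
        (\<exists>D. is_circle D \<and> {A i, A j, S} \<subseteq> D \<and> (\<forall>x\<in>C 1. \<exists>Y\<in>D. ell i x \<inter> ell j x = {Y}))) \<and>
      (collinear {A i, A j, S} \<longrightarrow> (\<forall>x\<in>C 1. \<nexists>Y. ell i x \<inter> ell j x = {Y}))" for i j
  proof (intro conjI impI ballI)
    assume "\<not> collinear {A i, A j, S}"
    then obtain n where n: "n \<noteq> 0" "S + a i \<in> diameter_circle S n" "S + a j \<in> diameter_circle S n"
      "\<And>u. cmod u = 1 \<Longrightarrow> tilted_line S (a i) u \<inter> tilted_line S (a j) u = {S + n * (of_real (Re u) * u)}"
      using tilted_lines_meet[OF a_nz a_nz] unfolding A_eq by metis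
    have "\<exists>Y\<in>diameter_circle S n. ell i x \<inter> ell j x = {Y}" if x: "x \<in> C 1" for x
    proof -
      obtain u where u: "cmod u = 1" "x = S + m 1 * v u"
        using x by (auto simp: C_iff)
      then show ?thesis
        using n(4)[OF u(1)] diameter_circle_iff_unit ell_eq[OF u(1)] by metis
    qed
    then show "\<exists>D. is_circle D \<and> {A i, A j, S} \<subseteq> D \<and> (\<forall>x\<in>C 1. \<exists>Y\<in>D. ell i x \<inter> ell j x = {Y})"
      using n is_circle_diameter_circle endpoint_in_diameter_circle unfolding A_eq
      by (intro exI[of _ "diameter_circle S n"]) simp
  next
    fix x assume "collinear {A i, A j, S}" "x \<in> C 1"
    moreover from this obtain u where u: "cmod u = 1" "x = S + m 1 * v u"
      by (auto simp: C_iff)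
    moreover have "u \<noteq> 0"
      using u by auto
    ultimately show "\<nexists>Y. ell i x \<inter> ell j x = {Y}"
      using tilted_lines_not_meet[OF a_nz a_nz] unfolding A_eq by (metis ell_eq)
  qed
  have diag_neq: "\<forall>x\<in>C 1 - {S}. X 1 x \<noteq> X 3 x \<and> X 2 x \<noteq> X 4 x"
  proof
    fix x assume "x \<in> C 1 - {S}"
    then obtain u where u: "cmod u = 1" "x = S + m 1 * v u" "v u \<noteq> 0"
      using v_nz by (auto simp: C_iff)
    then show "X 1 x \<noteq> X 3 x \<and> X 2 x \<noteq> X 4 x"
      using m_neq unfolding u(2) X_eq[OF u(1)] by simp
  qed
  \<comment> \<open>The diagonals are themselves tilted lines with a common \<open>u\<close>,
    through \<open>P\<close> and \<open>Q\<close>, so (iii) follows in the same way as (i).\<close>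
  have diag_lines: "\<exists>u. cmod u = 1 \<and> affine hull {X 1 x, X 3 x} = tilted_line S (b 2) u \<and>
      affine hull {X 2 x, X 4 x} = tilted_line S (b 1) u" if x: "x \<in> C 1 - {S}" for x
  proof -
    obtain u where u: "cmod u = 1" "x = S + m 1 * v u" "v u \<noteq> 0"
      using x v_nz by (auto simp: C_iff)
    then show ?thesis
      unfolding u(2) X_eq[OF u(1)] using hull_13 hull_24 by blast
  qed
  have diag: "\<not> collinear {P, Q, S} \<longrightarrow> (\<exists>C0. is_circle C0 \<and> {P, Q, S} \<subseteq> C0 \<and>
      (\<forall>x\<in>C 1 - {S}. \<exists>Y\<in>C0. affine hull {X 1 x, X 3 x} \<inter> affine hull {X 2 x, X 4 x} = {Y}))"
  proof
    assume "\<not> collinear {P, Q, S}"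
    then obtain n where n: "n \<noteq> 0" "S + b 2 \<in> diameter_circle S n" "S + b 1 \<in> diameter_circle S n"
      "\<And>u. cmod u = 1 \<Longrightarrow> tilted_line S (b 2) u \<inter> tilted_line S (b 1) u = {S + n * (of_real (Re u) * u)}"
      using tilted_lines_meet[OF b_nz b_nz] unfolding P_eq Q_eq by metis
    have "\<exists>Y\<in>diameter_circle S n. affine hull {X 1 x, X 3 x} \<inter> affine hull {X 2 x, X 4 x} = {Y}"
      if "x \<in> C 1 - {S}" for x
      using n(4) diameter_circle_iff_unit diag_lines[OF that] by metis
    then show "\<exists>C0. is_circle C0 \<and> {P, Q, S} \<subseteq> C0 \<and>
      (\<forall>x\<in>C 1 - {S}. \<exists>Y\<in>C0. affine hull {X 1 x, X 3 x} \<inter> affine hull {X 2 x, X 4 x} = {Y})"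
      using n is_circle_diameter_circle endpoint_in_diameter_circle unfolding P_eq Q_eq
      by (intro exI[of _ "diameter_circle S n"]) simp
  qed
  have diag_degenerate: "collinear {P, Q, S} \<longrightarrow> (\<forall>x\<in>C 1 - {S}. \<nexists>Y.
      affine hull {X 1 x, X 3 x} \<inter> affine hull {X 2 x, X 4 x} = {Y})"
  proof (intro impI ballI)
    fix x assume "collinear {P, Q, S}" "x \<in> C 1 - {S}"
    moreover from this obtain u where u: "cmod u = 1"
      "affine hull {X 1 x, X 3 x} = tilted_line S (b 2) u"
      "affine hull {X 2 x, X 4 x} = tilted_line S (b 1) u"
      using diag_lines by blast
    moreover have "u \<noteq> 0"
      using u by auto
    ultimately show "\<nexists>Y. affine hull {X 1 x, X 3 x} \<inter> affine hull {X 2 x, X 4 x} = {Y}"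
      using tilted_lines_not_meet[OF b_nz b_nz] unfolding P_eq Q_eq by metis
  qed
  have concyclic: "\<forall>x\<in>C 1. \<exists>D. is_circle D \<and> {X 1 x, X 2 x, X 3 x, X 4 x, S} \<subseteq> D"
  proof
    fix x assume "x \<in> C 1"
    then obtain u where u: "cmod u = 1" "x = S + m 1 * v u"
      by (auto simp: C_iff)
    show "\<exists>D. is_circle D \<and> {X 1 x, X 2 x, X 3 x, X 4 x, S} \<subseteq> D"
    proof (cases "v u = 0")
      \<comment> \<open>All four points are \<open>S\<close>, so any circle through \<open>S\<close>
        serves.\<close>
      case True
      then show ?thesis
        unfolding u(2) X_eq[OF u(1)]
        using is_circle_diameter_circle[of 1 S] endpoint_in_diameter_circle[of S 1]
        by (intro exI[of _ "diameter_circle S 1"]) simp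
    next
      case False
      \<comment> \<open>\<open>m i * v u * p (i + 2)\<close> equals \<open>g * v u\<close> for every
        \<open>i\<close>, so one diameter from \<open>S\<close> serves all four points.\<close>
      have "S + m i * v u \<in> diameter_circle S (g * v u)" for i
        using circle_memI[of "m i * v u" "i + 2"] m_nz[of i] False p_nz by (simp add: m_def)
      then show ?thesis
        unfolding u(2) X_eq[OF u(1)]
        using is_circle_diameter_circle[of "g * v u" S] endpoint_in_diameter_circle[of S "g * v u"] g_nz False
        by (intro exI[of _ "diameter_circle S (g * v u)"]) simp
    qed
  qed
  have collinear_diag: "\<forall>x\<in>C 1. collinear {X 1 x, X 3 x, P} \<and> collinear {X 2 x, X 4 x, Q}"
  proof
    fix x assume "x \<in> C 1"
    then obtain u where u: "cmod u = 1" "x = S + m 1 * v u"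
      by (auto simp: C_iff)
    show "collinear {X 1 x, X 3 x, P} \<and> collinear {X 2 x, X 4 x, Q}"
    proof (cases "v u = 0")
      \<comment> \<open>Here \<open>X 1 x = X 3 x\<close> and \<open>X 2 x = X 4 x\<close>, so each
        triple has at most two distinct points.\<close>
      case True
      then show ?thesis
        unfolding u(2) X_eq[OF u(1)] by (simp add: collinear_2)
    next
      case False
      have "P \<in> affine hull {X 1 x, X 3 x}" "Q \<in> affine hull {X 2 x, X 4 x}"
        unfolding u(2) X_eq[OF u(1)] hull_13[OF u(1) False] hull_24[OF u(1) False] P_eq Q_eq
        by (rule base_in_tilted_line)+
      then show ?thesis
        by (simp add: affine_hull_3_imp_collinear)
    qed
  qed
  show ?thesis
    by (intro conjI exI[of _ S] maps closes lines steiner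
        opposite[THEN conjunct1] opposite[THEN conjunct2]
        diag_neq diag diag_degenerate concyclic collinear_diag)
qed

end
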